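(* Let $f$ be a transcendental entire function of order strictly less than $1$ with $f(0)=1$, and let $(z_n)_{n\ge1}$ be its zeros, repeated according to multiplicity and numbered by increasing modulus, so that $$f(z)=\prod_{n=1}^\infty\Big(1-\frac{z}{z_n}\Big).$$ Then the double logarithmic order of $f$ equals the double logarithmic convergence exponent of its zeros, i.e. $\rho^{[2]}_f=\mathcal E(\log\log|z_n|)$.
   Context: For an unbounded continuous $f:\mathbb C\to\mathbb C$ let $M_f(r)=\max_{|z|\le r}|f(z)|$. The order is $\rho_f=\inf\{a>0\mid \log M_f(r)\le r^a\text{ for all sufficiently large }r\}$. The double logarithmic order is $\rho^{[2]}_f=\inf\{a>0\mid M_f(r)\le r^{(\log\log r)^a}\text{ for all sufficiently large }r\}\in[0,\infty]$ ($\inf\emptyset=\infty$). For a sequence $(w_n)$ with $|w_n|\to\infty$ (defined for sufficiently large $n$) the exponent of convergence is $\mathcal E(w_n)=\inf\{a>0\mid\sum_{n\ge n^*}|w_n|^{-a}<\infty\}$ ($\inf\emptyset=\infty$), where $n^*$ is such that $w_n$ is defined and $|w_n|>0$ for $n\ge n^*$. *)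

theory Defs
  imports "HOL-Complex_Analysis.Complex_Analysis"
begin

definition max_modulus :: "(complex \<Rightarrow> complex) \<Rightarrow> real \<Rightarrow> real" where
  "max_modulus f r = (SUP z\<in>cball 0 r. norm (f z))"

text \<open>
  The orders and the exponent of convergence take values in \<open>[0, \<infinity>]\<close>; in \<^typ>\<open>ereal\<close>
  the infimum of the empty set is \<open>\<infinity>\<close>.
\<close>

definition growth_order :: "(complex \<Rightarrow> complex) \<Rightarrow> ereal" where
  "growth_order f =
     (INF a\<in>{a::real. a > 0 \<and> (\<forall>\<^sub>F r in at_top. ln (max_modulus f r) \<le> r powr a)}. ereal a)"

definition double_log_order :: "(complex \<Rightarrow> complex) \<Rightarrow> ereal" where
  "double_log_order f =
     (INF a\<in>{a::real. a > 0 \<and>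
        (\<forall>\<^sub>F r in at_top. max_modulus f r \<le> r powr (ln (ln r) powr a))}. ereal a)"

text \<open>
  The sequence \<open>w\<close> need only be meaningful for large indices. Existentially quantifying the
  starting index \<open>N\<close> is harmless, as summability does not depend on it; in particular, the
  arbitrary values of \<open>w\<close> at small indices play no role.
\<close>

definition convergence_exponent :: "(nat \<Rightarrow> 'a::real_normed_vector) \<Rightarrow> ereal" where
  "convergence_exponent w =
     (INF a\<in>{a::real. a > 0 \<and>
        (\<exists>N. (\<forall>n\<ge>N. norm (w n) > 0) \<and> summable (\<lambda>n. norm (w (n + N)) powr (- a)))}. ereal a)"

definition transcendental_entire :: "(complex \<Rightarrow> complex) \<Rightarrow> bool" where
  "transcendental_entire f \<longleftrightarrow> f holomorphic_on UNIV \<and> \<not> (\<exists>p. f = poly p)"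

text \<open>
  The sequence is indexed from 1, so the value \<open>z 0\<close> is irrelevant. A zero has positive
  \<^const>\<open>zorder\<close>, so the equation for the cardinality also says that the set is finite.
\<close>

definition zeros_by_modulus :: "(complex \<Rightarrow> complex) \<Rightarrow> (nat \<Rightarrow> complex) \<Rightarrow> bool" where
  "zeros_by_modulus f z \<longleftrightarrow>
     (\<forall>n\<ge>1. f (z n) = 0) \<and>
     (\<forall>w. f w = 0 \<longrightarrow> int (card {n. n \<ge> 1 \<and> z n = w}) = zorder f w) \<and>
     mono_on {1..} (\<lambda>n. norm (z n))"

end

theory Submission
  imports Defs "HOL-Real_Asymp.Real_Asymp"
begin

text \<open>
  Divide \<open>f\<close> by the product \<open>P\<^sub>n\<close> over its first \<open>n\<close> zeros. If \<open>R\<close> is at least \<open>q + 1\<close> times their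
  moduli, then \<open>\<bar>P\<^sub>n\<bar> \<ge> q ^ n\<close> on the circle of radius \<open>R\<close>, so the maximum principle gives
  \<open>q ^ n \<bar>f / P\<^sub>n\<bar> \<le> M(R)\<close> on the disc. With \<open>q = 1\<close>, the quotient is zero-free on the disc up to the
  next zero, and the Borel-Caratheodory inequality applied to its logarithm shows that it tends to 1
  when the order is below 1; this yields the product formula. At the origin, \<open>q = 2\<close> bounds the
  number of zeros by a power of the modulus with exponent below 1 (hence absolute convergence), while \<open>q\<close>
  equal to the modulus \<open>r\<close> of the last zero turns \<open>M(r\<^sup>3) \<le> r ^ (3 (log log r\<^sup>3)\<^sup>\<alpha>)\<close> into a bound of
  order \<open>(log log r)\<^sup>\<alpha>\<close> for the number of zeros up to \<open>r\<close>.

  Conversely, put \<open>t\<^sub>n = (log log \<bar>z\<^sub>n\<bar>) ^ (- \<alpha>)\<close> with \<open>\<Sum> t\<^sub>n\<close> convergent. For large \<open>n\<close> the term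
  \<open>log (1 + r / \<bar>z\<^sub>n\<bar>)\<close> is at most \<open>2 (log r) (log log r\<^sup>2)\<^sup>\<alpha> t\<^sub>n\<close> if \<open>\<bar>z\<^sub>n\<bar> \<le> r\<^sup>2\<close>, and at most
  \<open>\<bar>z\<^sub>n\<bar> ^ (- 1/2) \<le> t\<^sub>n\<close> otherwise; summing over \<open>n\<close> bounds \<open>log M(r)\<close>.
\<close>

section \<open>Preliminaries on holomorphic functions and series\<close>

text \<open>The map sending \<open>h\<close> to \<open>h / (2 * A - h)\<close> takes the half-plane
  of real part below \<open>A\<close> into the unit disc and fixes 0. The Schwarz lemma on the
  rescaled disc bounds the image, and solving for \<open>norm (h w)\<close> gives the claim.\<close>

lemma Borel_Caratheodory_zero:
  assumes h: "h holomorphic_on ball 0 R" and "h 0 = 0"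
    and Re_less: "\<And>w. norm w < R \<Longrightarrow> Re (h w) < A" and w: "norm w < R"
  shows "norm (h w) \<le> 2 * A * norm w / (R - norm w)"
proof -
  have R: "R > 0" using w norm_ge_zero[of w] by linarith
  have A: "A > 0" using Re_less[of 0] \<open>h 0 = 0\<close> R by simp
  have less: "norm (h v) < norm (2 * A - h v)" if "norm v < R" for v
  proof -
    \<comment> \<open>The squared norms of \<open>2 * A - h v\<close> and \<open>h v\<close> differ
      by \<open>4 * A * (A - Re (h v))\<close>.\<close>
    have "A * Re (h v) < A * A" using Re_less[OF that] A by (intro mult_strict_left_mono) auto
    hence "(norm (h v))\<^sup>2 < (norm (2 * A - h v))\<^sup>2"
      unfolding cmod_power2 by (simp add: power2_eq_square algebra_simps)
    thus ?thesis by (rule power2_less_imp_less) simp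
  qed
  define \<phi> where "\<phi> = (\<lambda>v::complex. h (R * v) / (2 * A - h (R * v)))"
  have in_ball: "norm (R * v) < R" if "norm v < 1" for v :: complex
    using that R by (simp add: norm_mult)
  have "\<phi> holomorphic_on ball 0 1"
  proof -
    have "(h \<circ> (\<lambda>v. complex_of_real R * v)) holomorphic_on ball 0 1"
      by (rule holomorphic_on_compose_gen[OF _ h]) (use in_ball in \<open>auto intro!: holomorphic_intros\<close>)
    moreover have "2 * A - h (R * v) \<noteq> 0" if "v \<in> ball 0 1" for v :: complex
      using less[OF in_ball[of v]] that by auto
    ultimately show ?thesis
      unfolding \<phi>_def o_def by (intro holomorphic_intros) auto
  qed
  moreover have "\<phi> 0 = 0" using \<open>h 0 = 0\<close> by (simp add: \<phi>_def)
  moreover have "norm (\<phi> v) < 1" if "norm v < 1" for v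
    using less[OF in_ball[OF that]] unfolding \<phi>_def norm_divide
    by (subst divide_less_eq_1_pos) (use norm_ge_zero[of "h (R * v)"] in linarith)+
  moreover have "norm (w / R) < 1" using w R by (simp add: norm_divide)
  ultimately have "norm (\<phi> (w / R)) \<le> norm (w / R)"
    by (rule Schwarz_Lemma(1))
  hence "norm (h w) / norm (2 * A - h w) \<le> norm w / R"
    using R by (simp add: \<phi>_def norm_divide)
  moreover have "x * R \<le> y * D" if "x / D \<le> y / R" "D > 0" for x y D :: real
    using that R by (simp add: field_simps)
  ultimately have "norm (h w) * R \<le> norm w * norm (2 * A - h w)"
    using le_less_trans[OF norm_ge_zero less[OF w]] by blast
  also have "\<dots> \<le> norm w * (2 * A + norm (h w))"
    using A norm_triangle_ineq4[of "complex_of_real (2 * A)" "h w"]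
    by (intro mult_left_mono) auto
  finally show ?thesis using w by (simp add: field_simps)
qed

text \<open>Solved for \<open>y n\<close>, the counting bound says that \<open>y n\<close> grows at
  least like n to the power 1/\<alpha>; the terms are then dominated by a p-series with exponent
  \<beta>/\<alpha> > 1.\<close>

lemma summable_powr_of_counting_bound:
  fixes y :: "nat \<Rightarrow> real"
  assumes "0 < \<alpha>" "\<alpha> < \<beta>" "C > 0"
    and ev: "\<forall>\<^sub>F n in sequentially. y n > 0 \<and> real (Suc n) \<le> C * y n powr \<alpha>"
  shows "summable (\<lambda>n. y n powr (-\<beta>))"
proof (rule summable_comparison_test_ev)
  show "\<forall>\<^sub>F n in sequentially. norm (y n powr (-\<beta>)) \<le> (1 / C) powr (-\<beta>/\<alpha>) * real (Suc n) powr (-\<beta>/\<alpha>)"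
    using ev
  proof eventually_elim
    case (elim n)
    have "y n powr (-\<beta>) = (y n powr \<alpha>) powr (-\<beta>/\<alpha>)"
      using assms by (simp add: powr_powr)
    also have "\<dots> \<le> (real (Suc n) / C) powr (-\<beta>/\<alpha>)"
      using assms elim by (intro powr_mono2') (auto simp: field_simps)
    also have "\<dots> = (1 / C) powr (-\<beta>/\<alpha>) * real (Suc n) powr (-\<beta>/\<alpha>)"
      using assms by (subst powr_mult[symmetric]) auto
    finally show ?case by simp
  qed
  have "summable (\<lambda>n. real n powr (-\<beta>/\<alpha>))"
    using assms by (subst summable_real_powr_iff) (simp add: field_simps)
  hence "summable (\<lambda>n. real (Suc n) powr (-\<beta>/\<alpha>))"
    by (subst summable_Suc_iff)
  thus "summable (\<lambda>n. (1 / C) powr (-\<beta>/\<alpha>) * real (Suc n) powr (-\<beta>/\<alpha>))"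
    by (rule summable_mult)
qed

lemma zorder_one_minus_divide:
  fixes a u :: complex
  assumes "a \<noteq> 0"
  shows "zorder (\<lambda>w. 1 - w / a) u = (if u = a then 1 else 0)"
proof (cases "u = a")
  case True
  have "zorder (\<lambda>w. 1 - w / a) a = 1"
    by (rule zorder_eqI[of UNIV _ "\<lambda>_. - 1 / a"]) (use assms in \<open>auto simp: field_simps\<close>)
  with True show ?thesis by simp
next
  case False
  thus ?thesis using assms by (auto intro!: zorder_eq_0I analytic_intros)
qed

lemma norm_le_max_modulus:
  assumes "f holomorphic_on UNIV" "norm w \<le> r"
  shows "norm (f w) \<le> max_modulus f r"
  unfolding max_modulus_def
proof (rule cSUP_upper)
  have "compact ((\<lambda>z. norm (f z)) ` cball 0 r)"
    using holomorphic_on_imp_continuous_on[OF assms(1)]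
    by (intro compact_continuous_image continuous_on_norm) (auto intro: continuous_on_subset)
  thus "bdd_above ((\<lambda>z. norm (f z)) ` cball 0 r)"
    by (simp add: bounded_imp_bdd_above compact_imp_bounded)
qed (use assms in auto)

lemma holomorphic_divide_one_minus:
  fixes a :: complex
  assumes "g holomorphic_on UNIV" "g a = 0" "a \<noteq> 0"
  obtains g' where "g' holomorphic_on UNIV" "\<And>w. g w = g' w * (1 - w / a)"
proof -
  \<comment> \<open>The difference quotient at \<open>a\<close>, with the removable singularity
    filled; the factor \<open>- a\<close> then turns \<open>w - a\<close> into
    \<open>1 - w / a\<close>.\<close>
  define q where "q = (\<lambda>w. if w = a then deriv g a else g w / (w - a))"
  have "q holomorphic_on UNIV"
    by (rule pole_theorem_0[OF assms(1), of a]) (use assms in \<open>auto simp: q_def\<close>)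
  hence "(\<lambda>w. - a * q w) holomorphic_on UNIV"
    by (intro holomorphic_intros)
  moreover have "g w = - a * q w * (1 - w / a)" for w
    using assms by (auto simp: q_def field_simps)
  ultimately show ?thesis using that by blast
qed

section \<open>Zeros, cofactors and the maximum principle\<close>

locale entire_zeros =
  fixes f :: "complex \<Rightarrow> complex" and a :: "nat \<Rightarrow> complex"
  assumes hol: "f holomorphic_on UNIV" and f_0: "f 0 = 1"
    and zero: "f (a i) = 0"
    and card_zero: "f w = 0 \<Longrightarrow> int (card {i. a i = w}) = zorder f w"
    and mono_norm: "mono (\<lambda>i. norm (a i))"
begin

lemma zero_nonzero: "a i \<noteq> 0"
  using zero[of i] f_0 by auto

lemma eventually_nonzero: "\<forall>\<^sub>F w in at u. f w \<noteq> 0"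
  using non_zero_neighbour_alt[OF hol open_UNIV connected_UNIV, of u 0] f_0 by simp

lemma analytic: "f analytic_on S"
  using analytic_on_holomorphic hol by blast

text \<open>An infinite set has \<open>card\<close> 0, whereas the order of a zero is positive
  because \<open>f\<close> does not vanish identically near it.\<close>

lemma finite_index_zero: "finite {i. a i = u}"
proof (cases "f u = 0")
  case True
  hence "zorder f u > 0"
    using zorder_pos_iff'[OF analytic] eventually_nonzero
    by (simp add: eventually_frequently)
  hence "card {i. a i = u} > 0" using card_zero[OF True] by linarith
  thus ?thesis by (rule card_ge_0_finite)
next
  case False
  hence "{i. a i = u} = {}" using zero by auto
  thus ?thesis by simp
qed

lemma norm_at_top: "filterlim (\<lambda>n. norm (a n)) at_top sequentially"
proof -
  have "\<forall>\<^sub>F n in sequentially. norm (a n) > R" for R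
  proof -
    have "\<not> f constant_on UNIV"
      using f_0 zero[of 0] unfolding constant_on_def by (metis UNIV_I zero_neq_one)
    hence "finite {u \<in> cball 0 R. f u = 0}"
      using hol by (intro holomorphic_compact_finite_zeros[of f UNIV]) auto
    hence "finite (\<Union>u\<in>{u \<in> cball 0 R. f u = 0}. {i. a i = u})"
      using finite_index_zero by blast
    moreover have "{i. \<not> norm (a i) > R} \<subseteq> (\<Union>u\<in>{u \<in> cball 0 R. f u = 0}. {i. a i = u})"
      using zero by auto
    ultimately have "finite {i. \<not> norm (a i) > R}" by (rule finite_subset[rotated])
    thus ?thesis by (simp only: cofinite_eq_sequentially[symmetric] eventually_cofinite)
  qed
  thus ?thesis by (simp add: filterlim_at_top_dense)
qed

text \<open>Orders add under multiplication, and the product contributes 1 for each index below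
  \<open>n\<close> with value \<open>u\<close>, so the order of \<open>g\<close> at \<open>u\<close>
  counts the indices from \<open>n\<close> on. This permits further division at repeated zeros and
  makes the cofactor zero-free inside radius \<open>norm (a n)\<close>.\<close>

lemma cofactor_eq_0_iff:
  assumes g: "g holomorphic_on UNIV" and fg: "\<And>w. f w = g w * (\<Prod>i<n. 1 - w / a i)"
  shows "g u = 0 \<longleftrightarrow> (\<exists>i\<ge>n. a i = u)"
proof (cases "f u = 0")
  case False
  thus ?thesis using fg[of u] zero by auto
next
  case True
  have g_an: "g analytic_on S" for S using analytic_on_holomorphic g by blast
  have ev: "\<forall>\<^sub>F w in at u. g w * (\<Prod>i<n. 1 - w / a i) \<noteq> 0"
    using eventually_nonzero[of u] by (simp add: fg)
  have "zorder f u = zorder (\<lambda>w. g w * (\<Prod>i<n. 1 - w / a i)) u"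
    using fg by presburger
  also have "\<dots> = zorder g u + zorder (\<lambda>w. \<Prod>i<n. 1 - w / a i) u"
    using ev by (intro zorder_times_analytic g_an analytic_intros) (auto simp: zero_nonzero)
  also have "zorder (\<lambda>w. \<Prod>i<n. 1 - w / a i) u = (\<Sum>i<n. zorder (\<lambda>w. 1 - w / a i) u)"
    using ev by (intro zorder_prod_analytic analytic_intros) (auto simp: zero_nonzero elim: eventually_mono)
  also have "\<dots> = (\<Sum>i<n. if a i = u then 1 else 0)"
    by (intro sum.cong) (auto simp: zorder_one_minus_divide zero_nonzero)
  also have "\<dots> = int (card {i. i < n \<and> a i = u})"
    by (simp add: sum.If_cases lessThan_def Collect_conj_eq)
  finally have "int (card {i. a i = u}) = zorder g u + int (card {i. i < n \<and> a i = u})"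
    using card_zero[OF True] by simp
  moreover have "card {i. a i = u} = card {i. i < n \<and> a i = u} + card {i. n \<le> i \<and> a i = u}"
  proof -
    have "card ({i. i < n \<and> a i = u} \<union> {i. n \<le> i \<and> a i = u}) =
        card {i. i < n \<and> a i = u} + card {i. n \<le> i \<and> a i = u}"
      by (intro card_Un_disjoint finite_subset[OF _ finite_index_zero[of u]]) auto
    moreover have "{i. i < n \<and> a i = u} \<union> {i. n \<le> i \<and> a i = u} = {i. a i = u}" by auto
    ultimately show ?thesis by simp
  qed
  ultimately have "zorder g u = int (card {i. n \<le> i \<and> a i = u})" by simp
  moreover have "zorder g u > 0 \<longleftrightarrow> g u = 0"
  proof (rule zorder_pos_iff'[OF g_an])
    have "\<forall>\<^sub>F w in at u. g w \<noteq> 0" using ev by (auto elim: eventually_mono)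
    thus "\<exists>\<^sub>F w in at u. g w \<noteq> 0" by (simp add: eventually_frequently)
  qed
  moreover have "finite {i. n \<le> i \<and> a i = u}"
    by (rule finite_subset[OF _ finite_index_zero[of u]]) auto
  ultimately show ?thesis by (auto simp: card_gt_0_iff)
qed

lemma cofactor_exists:
  "\<exists>g. g holomorphic_on UNIV \<and> (\<forall>w. f w = g w * (\<Prod>i<n. 1 - w / a i))"
proof (induction n)
  case 0
  show ?case using hol by auto
next
  case (Suc n)
  then obtain g where g: "g holomorphic_on UNIV" "\<And>w. f w = g w * (\<Prod>i<n. 1 - w / a i)"
    by blast
  have "g (a n) = 0" using cofactor_eq_0_iff[OF g] by blast
  then obtain g' where "g' holomorphic_on UNIV" "\<And>w. g w = g' w * (1 - w / a n)"
    using holomorphic_divide_one_minus[OF g(1)] zero_nonzero by metis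
  with g(2) show ?case by (intro exI[of _ g']) simp
qed

lemma cofactor_bound:
  assumes g: "g holomorphic_on UNIV" and fg: "\<And>w. f w = g w * (\<Prod>i<n. 1 - w / a i)"
    and q: "q > 0" and R: "\<And>i. i < n \<Longrightarrow> (q + 1) * norm (a i) \<le> R" and w: "norm w \<le> R"
  shows "q ^ n * norm (g w) \<le> max_modulus f R"
proof (cases "R = 0")
  \<comment> \<open>No zero satisfies the radius hypothesis on the degenerate disc, so the product
    is empty.\<close>
  case True
  with w have "w = 0" by simp
  moreover have "n = 0"
  proof (rule ccontr)
    assume "n \<noteq> 0"
    hence "(q + 1) * norm (a 0) \<le> 0" using R[of 0] True by simp
    moreover have "(q + 1) * norm (a 0) > 0" using q zero_nonzero[of 0] by simp
    ultimately show False by linarith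
  qed
  ultimately show ?thesis using fg[of 0] norm_le_max_modulus[OF hol, of 0 R] True by simp
next
  case False
  hence R0: "R > 0" using w norm_ge_zero[of w] by linarith
  have "norm (g w) \<le> max_modulus f R / q ^ n"
  proof (rule maximum_modulus_frontier[of g "cball 0 R"])
    fix v assume "v \<in> frontier (cball (0::complex) R)"
    hence v: "norm v = R" by (simp add: frontier_cball)
    have "q ^ n = (\<Prod>i<n. q)" by simp
    also have "\<dots> \<le> (\<Prod>i<n. norm (1 - v / a i))"
    proof (rule prod_mono, safe)
      fix i assume "i < n"
      hence "q + 1 \<le> norm (v / a i)"
        using R[of i] zero_nonzero[of i] v by (simp add: norm_divide field_simps)
      also have "\<dots> \<le> norm (1 - v / a i) + 1"
        using norm_triangle_ineq3[of "v / a i" 1] by (simp add: norm_minus_commute)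
      finally show "q \<le> norm (1 - v / a i)" by simp
    qed (use q in auto)
    finally have "q ^ n * norm (g v) \<le> norm (f v)"
      unfolding fg[of v] norm_mult prod_norm[symmetric] by (subst mult.commute) (rule mult_left_mono, auto)
    also have "\<dots> \<le> max_modulus f R" by (rule norm_le_max_modulus[OF hol]) (simp add: v)
    finally show "norm (g v) \<le> max_modulus f R / q ^ n"
      using q by (simp add: field_simps)
  qed (use g w in \<open>auto intro: holomorphic_on_subset holomorphic_on_imp_continuous_on\<close>)
  thus ?thesis using q by (simp add: field_simps)
qed

text \<open>A stand-in for Jensen's formula: the cofactor of the first \<open>Suc n\<close> factors
  (indices 0 to \<open>n\<close>) equals 1 at the origin, so \<open>cofactor_bound\<close> there
  turns growth into a count of zeros.\<close>

lemma power_le_max_modulus: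
  assumes "q > 0" "(q + 1) * norm (a n) \<le> R"
  shows "q ^ Suc n \<le> max_modulus f R"
proof -
  obtain g where g: "g holomorphic_on UNIV" "\<And>w. f w = g w * (\<Prod>i<Suc n. 1 - w / a i)"
    using cofactor_exists[of "Suc n"] by blast
  have "(q + 1) * norm (a i) \<le> R" if "i < Suc n" for i
  proof -
    have "(q + 1) * norm (a i) \<le> (q + 1) * norm (a n)"
      using that assms monoD[OF mono_norm, of i n] by (intro mult_left_mono) auto
    with assms show ?thesis by linarith
  qed
  moreover have "R \<ge> 0"
    using assms by (smt (verit) mult_nonneg_nonneg norm_ge_zero)
  ultimately have "q ^ Suc n * norm (g 0) \<le> max_modulus f R"
    by (intro cofactor_bound[OF g] assms) auto
  thus ?thesis using g(2)[of 0] f_0 by simp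
qed

lemma max_modulus_ge_1: "r \<ge> 0 \<Longrightarrow> 1 \<le> max_modulus f r"
  using norm_le_max_modulus[OF hol, of 0 r] f_0 by simp

lemma cofactor_log:
  assumes w: "norm w < norm (a n)"
  shows "\<exists>h. f w = exp h * (\<Prod>i<n. 1 - w / a i) \<and>
    norm h \<le> 2 * (ln (max_modulus f (2 * norm (a n))) + 1) * norm w / (norm (a n) - norm w)"
proof -
  define R where "R = norm (a n)"
  have R: "R > 0" using zero_nonzero by (simp add: R_def)
  obtain g where g: "g holomorphic_on UNIV" "\<And>w. f w = g w * (\<Prod>i<n. 1 - w / a i)"
    using cofactor_exists[of n] by blast
  have nz: "g u \<noteq> 0" if "u \<in> ball 0 R" for u
    using that cofactor_eq_0_iff[OF g, of u] monoD[OF mono_norm] by (force simp: R_def)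
  obtain h where h: "h holomorphic_on ball 0 R" "\<And>u. u \<in> ball 0 R \<Longrightarrow> exp (h u) = g u"
    by (rule holomorphic_logarithm_exists[of "ball 0 R" g 0])
       (use nz R g(1) in \<open>auto intro: holomorphic_on_subset\<close>)
  \<comment> \<open>Subtracting \<open>h 0\<close> keeps a logarithm of \<open>g\<close> and makes
    it vanish at the origin, as \<open>Borel_Caratheodory_zero\<close> requires.\<close>
  have "exp (h 0) = 1" using h(2)[of 0] R g(2)[of 0] f_0 by simp
  hence exp_h: "exp (h u - h 0) = g u" if "norm u < R" for u
    using that h(2)[of u] by (simp add: exp_diff)
  have "norm (h w - h 0) \<le> 2 * (ln (max_modulus f (2 * R)) + 1) * norm w / (R - norm w)"
  proof (rule Borel_Caratheodory_zero[of "\<lambda>u. h u - h 0"])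
    fix u :: complex assume u: "norm u < R"
    \<comment> \<open>The case \<open>q = 1\<close> of \<open>cofactor_bound\<close>, which is why
      the radius is doubled.\<close>
    have "1 ^ n * norm (g u) \<le> max_modulus f (2 * R)"
    proof (rule cofactor_bound[OF g])
      show "norm u \<le> 2 * R" using u R by linarith
    qed (use monoD[OF mono_norm] in \<open>auto simp: R_def\<close>)
    hence "exp (Re (h u - h 0)) \<le> max_modulus f (2 * R)"
      using exp_h[OF u, symmetric] by (simp only: norm_exp_eq_Re) simp
    moreover have "max_modulus f (2 * R) \<ge> 1" using R by (intro max_modulus_ge_1) simp
    ultimately have "Re (h u - h 0) \<le> ln (max_modulus f (2 * R))"
      by (subst ln_ge_iff) auto
    \<comment> \<open>The added 1 supplies the strict inequality.\<close>
    thus "Re (h u - h 0) < ln (max_modulus f (2 * R)) + 1" by simp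
  qed (use h w in \<open>auto simp: R_def intro!: holomorphic_intros\<close>)
  thus ?thesis
    using exp_h[of w] w g(2)[of w] unfolding R_def by (intro exI[of _ "h w - h 0"]) auto
qed

section \<open>Product formula for order below 1\<close>

lemma order_less_1D:
  assumes "growth_order f < 1"
  obtains \<alpha> where "0 < \<alpha>" "\<alpha> < 1" "\<forall>\<^sub>F r in at_top. ln (max_modulus f r) \<le> r powr \<alpha>"
  using assms unfolding growth_order_def by (auto simp: INF_less_iff)

lemma partial_products_tendsto:
  assumes "growth_order f < 1"
  shows "(\<lambda>n. \<Prod>i<n. 1 - w / a i) \<longlonglongrightarrow> f w"
proof -
  obtain \<alpha> where \<alpha>: "0 < \<alpha>" "\<alpha> < 1" "\<forall>\<^sub>F r in at_top. ln (max_modulus f r) \<le> r powr \<alpha>"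
    using order_less_1D[OF assms] .
  obtain h where h: "\<And>n. norm w < norm (a n) \<Longrightarrow> f w = exp (h n) * (\<Prod>i<n. 1 - w / a i) \<and>
    norm (h n) \<le> 2 * (ln (max_modulus f (2 * norm (a n))) + 1) * norm w / (norm (a n) - norm w)"
    using cofactor_log by metis
  have ev_w: "\<forall>\<^sub>F n in sequentially. norm w < norm (a n)"
    using norm_at_top by (simp add: filterlim_at_top_dense)
  \<comment> \<open>For fixed \<open>w\<close> the numerator of the bound has order
    \<open>norm (a n) powr \<alpha>\<close> and the denominator order \<open>norm (a n)\<close>,
    with \<alpha> < 1.\<close>
  have "h \<longlonglongrightarrow> 0"
  proof (rule Lim_null_comparison)
    have "\<forall>\<^sub>F r in at_top. ln (max_modulus f (2 * r)) \<le> (2 * r) powr \<alpha>"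
      by (rule eventually_compose_filterlim[OF \<alpha>(3)]) real_asymp
    hence "\<forall>\<^sub>F n in sequentially. ln (max_modulus f (2 * norm (a n))) \<le> (2 * norm (a n)) powr \<alpha>"
      using norm_at_top by (rule eventually_compose_filterlim)
    thus "\<forall>\<^sub>F n in sequentially. norm (h n)
        \<le> 2 * ((2 * norm (a n)) powr \<alpha> + 1) * norm w / (norm (a n) - norm w)"
      using ev_w
    proof eventually_elim
      case (elim n)
      show ?case
        using conjunct2[OF h[OF elim(2)]]
        by (rule order_trans) (use elim in \<open>intro divide_right_mono mult_right_mono; simp\<close>)
    qed
    have "((\<lambda>r. 2 * ((2 * r) powr \<alpha> + 1) * norm w / (r - norm w)) \<longlongrightarrow> 0) at_top"
      using \<alpha> by real_asymp
    thus "(\<lambda>n. 2 * ((2 * norm (a n)) powr \<alpha> + 1) * norm w / (norm (a n) - norm w)) \<longlonglongrightarrow> 0"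
      using norm_at_top by (rule filterlim_compose)
  qed
  hence "(\<lambda>n. f w * exp (- h n)) \<longlonglongrightarrow> f w * exp (- 0)"
    by (intro tendsto_intros)
  moreover have "\<forall>\<^sub>F n in sequentially. f w * exp (- h n) = (\<Prod>i<n. 1 - w / a i)"
    using ev_w by eventually_elim (use h in \<open>simp add: exp_minus field_simps\<close>)
  ultimately show ?thesis
    by (simp add: tendsto_cong)
qed

lemma summable_inverse_norm:
  assumes "growth_order f < 1"
  shows "summable (\<lambda>n. norm (a n) powr (-1))"
proof -
  obtain \<alpha> where \<alpha>: "0 < \<alpha>" "\<alpha> < 1" "\<forall>\<^sub>F r in at_top. ln (max_modulus f r) \<le> r powr \<alpha>"
    using order_less_1D[OF assms] .
  have "\<forall>\<^sub>F r in at_top. ln (max_modulus f (3 * r)) \<le> (3 * r) powr \<alpha>"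
    by (rule eventually_compose_filterlim[OF \<alpha>(3)]) real_asymp
  hence "\<forall>\<^sub>F n in sequentially. ln (max_modulus f (3 * norm (a n))) \<le> (3 * norm (a n)) powr \<alpha>"
    using norm_at_top by (rule eventually_compose_filterlim)
  hence "\<forall>\<^sub>F n in sequentially. norm (a n) > 0 \<and>
      real (Suc n) \<le> 3 powr \<alpha> / ln 2 * norm (a n) powr \<alpha>"
  proof eventually_elim
    case (elim n)
    \<comment> \<open>Here \<open>q = 2\<close>, hence the radius \<open>3 * norm (a n)\<close>; a
      base above 1 is needed for the logarithm to count zeros.\<close>
    have "2 ^ Suc n \<le> max_modulus f (3 * norm (a n))"
      by (rule power_le_max_modulus) auto
    hence "ln (2 ^ Suc n) \<le> ln (max_modulus f (3 * norm (a n)))"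
      by (subst ln_le_cancel_iff) (auto intro: less_le_trans[rotated])
    hence "real (Suc n) * ln 2 \<le> (3 * norm (a n)) powr \<alpha>"
      using elim by (simp add: ln_realpow del: power_Suc)
    thus ?case using zero_nonzero[of n] by (simp add: powr_mult field_simps)
  qed
  thus ?thesis using \<alpha>
    by (intro summable_powr_of_counting_bound[where \<alpha> = \<alpha> and C = "3 powr \<alpha> / ln 2"]) auto
qed

text \<open>At a zero of \<open>f\<close>, the limit of the partial products alone does not give
  \<open>has_prod\<close>, which also asks for a nonzero limit after the vanishing factors are
  dropped. Absolute convergence provides this, and the partial products identify the value.\<close>

lemma has_prod:
  assumes "growth_order f < 1"
  shows "(\<lambda>n. 1 - w / a n) has_prod f w"
proof -
  have "summable (\<lambda>n. norm w * norm (a n) powr (-1))"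
    by (intro summable_mult summable_inverse_norm assms)
  hence "summable (\<lambda>n. norm ((1 - w / a n) - 1))"
    by (simp add: norm_divide powr_minus field_simps)
  hence conv: "convergent_prod (\<lambda>n. 1 - w / a n)"
    by (intro abs_convergent_prod_imp_convergent_prod summable_imp_abs_convergent_prod)
  have "(\<lambda>n. \<Prod>i\<le>n. 1 - w / a i) \<longlonglongrightarrow> f w"
    using LIMSEQ_Suc[OF partial_products_tendsto[OF assms]] by (simp only: lessThan_Suc_atMost)
  hence "prodinf (\<lambda>n. 1 - w / a n) = f w"
    using convergent_prod_LIMSEQ[OF conv] LIMSEQ_unique by blast
  thus ?thesis using convergent_prod_has_prod[OF conv] by simp
qed

section \<open>From the growth of \<open>f\<close> to its zeros\<close>

lemma summable_of_double_log_growth: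
  assumes "0 < \<alpha>" "\<alpha> < \<beta>"
    and growth: "\<forall>\<^sub>F r in at_top. max_modulus f r \<le> r powr (ln (ln r) powr \<alpha>)"
  shows "summable (\<lambda>n. ln (ln (norm (a n))) powr (-\<beta>))"
proof -
  \<comment> \<open>The cube leaves room for \<open>q = r\<close>, since eventually
    \<open>(r + 1) * r \<le> r ^ 3\<close>, and it only adds \<open>ln 3\<close> to
    \<open>ln (ln r)\<close>.\<close>
  have "\<forall>\<^sub>F r in at_top. max_modulus f (r ^ 3) \<le> (r ^ 3) powr (ln (ln (r ^ 3)) powr \<alpha>)"
    by (rule eventually_compose_filterlim[OF growth]) real_asymp
  moreover have "\<forall>\<^sub>F r::real in at_top. (r + 1) * r \<le> r ^ 3 \<and> ln r > 1 \<and> ln 3 \<le> ln (ln r) \<and> r > 1"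
    by (intro eventually_conj; real_asymp)
  ultimately have "\<forall>\<^sub>F r in at_top. max_modulus f (r ^ 3) \<le> (r ^ 3) powr (ln (ln (r ^ 3)) powr \<alpha>) \<and>
      (r + 1) * r \<le> r ^ 3 \<and> ln r > 1 \<and> ln 3 \<le> ln (ln r) \<and> r > 1"
    by (rule eventually_conj)
  from eventually_compose_filterlim[OF this norm_at_top]
  have "\<forall>\<^sub>F n in sequentially. ln (ln (norm (a n))) > 0 \<and>
      real (Suc n) \<le> 3 * 2 powr \<alpha> * ln (ln (norm (a n))) powr \<alpha>"
  proof eventually_elim
    case (elim n)
    define r where "r = norm (a n)"
    have r: "r > 1" "ln r > 1" "ln 3 \<le> ln (ln r)" "(r + 1) * r \<le> r ^ 3"
      "max_modulus f (r ^ 3) \<le> (r ^ 3) powr (ln (ln (r ^ 3)) powr \<alpha>)"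
      using elim by (simp_all add: r_def)
    have ll: "ln (ln r) > 0" using r by simp
    \<comment> \<open>With base \<open>r\<close>, both logarithms carry a factor
      \<open>ln r\<close>, which cancels below.\<close>
    have "r ^ Suc n \<le> max_modulus f (r ^ 3)"
      using r by (intro power_le_max_modulus) (auto simp: r_def)
    hence "r ^ Suc n \<le> (r ^ 3) powr (ln (ln (r ^ 3)) powr \<alpha>)" using r by linarith
    hence "ln (r ^ Suc n) \<le> ln ((r ^ 3) powr (ln (ln (r ^ 3)) powr \<alpha>))"
      using r by (subst ln_le_cancel_iff) auto
    hence "real (Suc n) * ln r \<le> ln (ln (r ^ 3)) powr \<alpha> * (3 * ln r)"
      using r by (simp add: ln_realpow ln_powr del: power_Suc)
    hence "real (Suc n) * ln r \<le> 3 * ln (ln (r ^ 3)) powr \<alpha> * ln r"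
      by (simp only: mult_ac)
    hence "real (Suc n) \<le> 3 * ln (ln (r ^ 3)) powr \<alpha>"
      using r by (subst (asm) mult_le_cancel_right_pos) auto
    also have "ln (ln (r ^ 3)) = ln 3 + ln (ln r)"
      using r by (simp add: ln_realpow ln_mult)
    also have "(ln 3 + ln (ln r)) powr \<alpha> \<le> (2 * ln (ln r)) powr \<alpha>"
      using r ll assms by (intro powr_mono2) auto
    also have "\<dots> = 2 powr \<alpha> * ln (ln r) powr \<alpha>"
      using ll by (simp add: powr_mult)
    finally show ?case using ll by (simp add: r_def)
  qed
  thus ?thesis
    using assms by (intro summable_powr_of_counting_bound[where \<alpha> = \<alpha> and C = "3 * 2 powr \<alpha>"]) auto
qed

section \<open>From the zeros of \<open>f\<close> to its growth\<close>

text \<open>Each factor has modulus at most \<open>1 + r / norm (a i)\<close>; the resulting bound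
  is uniform in the number of factors and passes to the limit.\<close>

lemma max_modulus_le_exp:
  assumes "growth_order f < 1" and "r \<ge> 0"
    and B: "\<And>n. (\<Sum>i<n. ln (1 + r / norm (a i))) \<le> B"
  shows "max_modulus f r \<le> exp B"
  unfolding max_modulus_def
proof (rule cSUP_least)
  fix w :: complex assume "w \<in> cball 0 r"
  hence w: "norm w \<le> r" by simp
  have "norm (\<Prod>i<n. 1 - w / a i) \<le> exp B" for n
  proof -
    have pos: "1 + r / norm (a i) > 0" for i
      using \<open>r \<ge> 0\<close> by (simp add: add_pos_nonneg)
    have "norm (\<Prod>i<n. 1 - w / a i) \<le> (\<Prod>i<n. 1 + r / norm (a i))"
      unfolding prod_norm[symmetric]
    proof (rule prod_mono, safe)
      fix i
      have "norm (1 - w / a i) \<le> 1 + norm (w / a i)"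
        using norm_triangle_ineq4[of 1 "w / a i"] by simp
      also have "\<dots> \<le> 1 + r / norm (a i)"
        using w by (simp add: norm_divide divide_right_mono)
      finally show "norm (1 - w / a i) \<le> 1 + r / norm (a i)" .
    qed auto
    also have "\<dots> = exp (\<Sum>i<n. ln (1 + r / norm (a i)))"
      using pos by (simp add: exp_sum)
    also have "\<dots> \<le> exp B" using B by simp
    finally show ?thesis .
  qed
  with tendsto_norm[OF partial_products_tendsto[OF assms(1), of w]]
  show "norm (f w) \<le> exp B"
    by (intro LIMSEQ_le_const2) auto
qed (use assms in auto)

lemma double_log_growth_of_summable:
  assumes order: "growth_order f < 1" and "0 < \<alpha>" "\<alpha> < \<beta>"
    and sum: "summable (\<lambda>n. ln (ln (norm (a n))) powr (-\<alpha>))"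
  shows "\<forall>\<^sub>F r in at_top. max_modulus f r \<le> r powr (ln (ln r) powr \<beta>)"
proof -
  define t where "t = (\<lambda>n. ln (ln (norm (a n))) powr (-\<alpha>))"
  define S where "S = (\<Sum>n. t n)"
  have S: "(\<Sum>i<n. t i) \<le> S" for n
    unfolding S_def using sum by (intro sum_le_suminf) (auto simp: t_def)
  \<comment> \<open>The power \<open>r powr (-1/2)\<close> decays faster than every power of
    \<open>ln (ln r)\<close>; this will control the zeros of modulus above
    \<open>r\<^sup>2\<close>.\<close>
  have "\<forall>\<^sub>F r::real in at_top. r > 1 \<and> ln r > 1 \<and> r powr (-1/2) \<le> ln (ln r) powr (-\<alpha>)"
    using \<open>0 < \<alpha>\<close> by (intro eventually_conj; real_asymp)
  from eventually_compose_filterlim[OF this norm_at_top]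
  obtain N where N: "\<And>n. n \<ge> N \<Longrightarrow> norm (a n) > 1 \<and> ln (norm (a n)) > 1 \<and> norm (a n) powr (-1/2) \<le> t n"
    unfolding eventually_sequentially t_def by blast
  \<comment> \<open>\<open>2 * N\<close> pays for the first \<open>N\<close> terms and
    \<open>3 * S\<close> for the others; the 1 keeps \<open>C\<close> positive.\<close>
  define C where "C = 2 * real N + 3 * S + 1"
  have S0: "S \<ge> 0" using S[of 0] by simp
  hence C: "C > 0" by (simp add: C_def)
  define L where "L = (\<lambda>r::real. ln (ln (r\<^sup>2)) powr \<alpha>)"
  have norm_0: "norm (a 0) > 0" using zero_nonzero by simp
  \<comment> \<open>\<open>L r\<close> has the order of \<open>ln (ln r) powr \<alpha>\<close>, so
    \<alpha> < \<beta> absorbs both \<open>C\<close> and the square.\<close>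
  have "\<forall>\<^sub>F r in at_top. C * (ln r * L r) \<le> ln (ln r) powr \<beta> * ln r"
    unfolding L_def using C \<open>0 < \<alpha>\<close> \<open>\<alpha> < \<beta>\<close> by real_asymp
  moreover have "\<forall>\<^sub>F r in at_top. 1 \<le> L r"
    unfolding L_def using \<open>0 < \<alpha>\<close> by real_asymp
  \<comment> \<open>As \<open>a 0\<close> has the least modulus, this one condition covers all terms
    with \<open>i < N\<close>.\<close>
  moreover have "\<forall>\<^sub>F r in at_top. 1 + r / norm (a 0) \<le> r\<^sup>2"
    using norm_0 by real_asymp
  moreover have "\<forall>\<^sub>F r::real in at_top. 1 + r \<le> r\<^sup>2" "\<forall>\<^sub>F r::real in at_top. 1 \<le> ln r"
    by real_asymp+
  ultimately show ?thesis
    using eventually_gt_at_top[of 1]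
  proof eventually_elim
    case (elim r)
    have term_small: "ln (1 + r / norm (a i)) \<le> 2 * ln r" if "1 + r / norm (a i) \<le> r\<^sup>2" for i
    proof -
      have "ln (1 + r / norm (a i)) \<le> ln (r\<^sup>2)"
        using that elim by (subst ln_le_cancel_iff) (auto simp: add_pos_nonneg)
      thus ?thesis using elim by (simp add: ln_realpow)
    qed
    have term_le: "ln (1 + r / norm (a i)) \<le> (if i < N then 2 * ln r else 0) + (2 * ln r * L r + 1) * t i" for i
    proof (cases "i < N")
      case True
      have "1 + r / norm (a i) \<le> 1 + r / norm (a 0)"
        using elim norm_0 monoD[OF mono_norm, of 0 i] by (intro add_left_mono divide_left_mono) (auto simp: zero_nonzero)
      hence "ln (1 + r / norm (a i)) \<le> 2 * ln r"
        using elim by (intro term_small) linarith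
      moreover have "0 \<le> (2 * ln r * L r + 1) * t i"
        using elim by (intro mult_nonneg_nonneg) (auto simp: t_def)
      ultimately show ?thesis using True by simp
    next
      case False
      hence i: "norm (a i) > 1" "ln (norm (a i)) > 1" "norm (a i) powr (-1/2) \<le> t i"
        using N[of i] by auto
      have "ln (1 + r / norm (a i)) \<le> (2 * ln r * L r + 1) * t i"
      proof (cases "norm (a i) \<le> r\<^sup>2")
        case True
        have lns: "0 < ln (ln (norm (a i)))" "ln (ln (norm (a i))) \<le> ln (ln (r\<^sup>2))"
          using i True elim by (auto intro!: ln_mono)
        \<comment> \<open>Up to modulus \<open>r\<^sup>2\<close>, \<open>t i\<close> is at least
          \<open>1 / L r\<close>, so each such term can be paid for with a multiple of
          \<open>t i\<close>.\<close>
        have "1 = ln (ln (norm (a i))) powr \<alpha> * t i"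
          using lns by (simp add: t_def powr_minus)
        also have "\<dots> \<le> L r * t i"
          unfolding L_def using lns \<open>0 < \<alpha>\<close> by (intro mult_right_mono powr_mono2) (auto simp: t_def)
        finally have 1: "1 \<le> L r * t i" .
        have "1 + r / norm (a i) \<le> 1 + r"
          using i elim by (simp add: divide_le_eq)
        hence "ln (1 + r / norm (a i)) \<le> 2 * ln r"
          using elim by (intro term_small) linarith
        also have "\<dots> \<le> 2 * ln r * (L r * t i)"
          using 1 elim by simp
        also have "\<dots> \<le> (2 * ln r * L r + 1) * t i"
          by (simp add: algebra_simps t_def)
        finally show ?thesis .
      next
        case False
        have "ln (1 + r / norm (a i)) \<le> r / norm (a i)"
          using elim i by (intro ln_add_one_self_le_self) auto
        \<comment> \<open>Modulus above \<open>r\<^sup>2\<close> means that \<open>r\<close> is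
          below the square root of \<open>norm (a i)\<close>.\<close>
        also have "\<dots> \<le> norm (a i) powr (1/2) / norm (a i)"
          using False elim i by (intro divide_right_mono) (auto simp: powr_half_sqrt real_le_rsqrt)
        also have "\<dots> = norm (a i) powr (1/2) * norm (a i) powr (-1)"
          using i by (simp add: powr_minus field_simps)
        also have "\<dots> = norm (a i) powr (-1/2)"
          by (subst powr_add[symmetric]) simp
        also have "\<dots> \<le> t i" by (rule i)
        also have "\<dots> \<le> (2 * ln r * L r + 1) * t i"
          using elim by (simp add: algebra_simps t_def)
        finally show ?thesis .
      qed
      thus ?thesis using False by simp
    qed
    have "(\<Sum>i<n. ln (1 + r / norm (a i))) \<le> C * (ln r * L r)" for n
    proof -
      have "(\<Sum>i<n. ln (1 + r / norm (a i))) \<le>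
          (\<Sum>i<n. (if i < N then 2 * ln r else 0) + (2 * ln r * L r + 1) * t i)"
        by (intro sum_mono term_le)
      also have "\<dots> = (\<Sum>i<n. if i < N then 2 * ln r else 0) + (2 * ln r * L r + 1) * (\<Sum>i<n. t i)"
        by (simp add: sum.distrib sum_distrib_left)
      also have "(\<Sum>i<n. if i < N then 2 * ln r else 0) = real (card ({..<n} \<inter> {i. i < N})) * (2 * ln r)"
        by (simp add: sum.If_cases)
      also have "\<dots> \<le> real N * (2 * ln r)"
        using elim card_mono[of "{..<N}" "{..<n} \<inter> {i. i < N}"] by (intro mult_right_mono) auto
      also have "\<dots> \<le> real N * (2 * (ln r * L r))"
        using elim by (intro mult_left_mono) auto
      \<comment> \<open>The lone 1 is enlarged to \<open>ln r * L r\<close>, whence the coefficient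
        3 of \<open>S\<close> in \<open>C\<close>.\<close>
      also have "(2 * ln r * L r + 1) * (\<Sum>i<n. t i) \<le> (2 * ln r * L r + ln r * L r) * S"
      proof (intro mult_mono add_left_mono)
        show "1 \<le> ln r * L r" using elim mult_mono[of 1 "ln r" 1 "L r"] by simp
      qed (use elim S S0 in \<open>auto intro!: sum_nonneg simp: t_def\<close>)
      also have "real N * (2 * (ln r * L r)) + (2 * ln r * L r + ln r * L r) * S \<le> C * (ln r * L r)"
        using elim by (simp add: C_def algebra_simps)
      finally show ?thesis by simp
    qed
    hence "max_modulus f r \<le> exp (C * (ln r * L r))"
      using elim by (intro max_modulus_le_exp order) auto
    also have "\<dots> \<le> exp (ln (ln r) powr \<beta> * ln r)"
      using elim by simp
    also have "\<dots> = r powr (ln (ln r) powr \<beta>)"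
      using elim by (simp add: powr_def)
    finally show ?case .
  qed
qed

end

section \<open>Comparison of the two infima\<close>

text \<open>Both growth estimates replace an exponent by an arbitrary larger one; this loss
  disappears in the infimum. An empty \<open>A\<close> gives the bound \<infinity>.\<close>

lemma INF_ereal_le_INF_ereal:
  fixes A B :: "real set"
  assumes "\<And>x y. x \<in> A \<Longrightarrow> x < y \<Longrightarrow> y \<in> B"
  shows "(INF x\<in>B. ereal x) \<le> (INF x\<in>A. ereal x)"
proof (rule INF_greatest)
  fix x assume x: "x \<in> A"
  show "(INF y\<in>B. ereal y) \<le> ereal x"
  proof (rule ereal_le_epsilon2)
    fix e :: real assume "e > 0"
    hence "x + e \<in> B" using assms[OF x, of "x + e"] by simp
    thus "(INF y\<in>B. ereal y) \<le> ereal x + ereal e" by (auto intro: INF_lower)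
  qed
qed

text \<open>Eventual positivity provides a starting index, and summability is invariant under
  shifts.\<close>

lemma convergence_exponent_eq:
  assumes "\<forall>\<^sub>F n in sequentially. norm (w n) > 0"
  shows "convergence_exponent w = (INF s\<in>{s. s > 0 \<and> summable (\<lambda>n. norm (w n) powr (-s))}. ereal s)"
proof -
  have "(\<exists>N. (\<forall>n\<ge>N. norm (w n) > 0) \<and> summable (\<lambda>n. norm (w (n + N)) powr (-s))) \<longleftrightarrow>
      summable (\<lambda>n. norm (w n) powr (-s))" for s
    using assms summable_iff_shift[of "\<lambda>n. norm (w n) powr (-s)"]
    unfolding eventually_sequentially by blast
  thus ?thesis unfolding convergence_exponent_def by simp
qed

theorem theorem8p3:
  fixes f :: "complex \<Rightarrow> complex" and z :: "nat \<Rightarrow> complex"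
  assumes "transcendental_entire f"
    and "growth_order f < 1"
    and "f 0 = 1"
    and "zeros_by_modulus f z"
  shows "(\<forall>w. (\<lambda>n. 1 - w / z (Suc n)) has_prod f w) \<and>
         double_log_order f = convergence_exponent (\<lambda>n. ln (ln (norm (z n))))"
proof -
  \<comment> \<open>The shift by one matches the numbering from 1 to the locale's numbering from 0
    and leaves out \<open>z 0\<close>.\<close>
  interpret entire_zeros f "\<lambda>n. z (Suc n)"
  proof
    fix w assume "f w = 0"
    moreover have "{n. n \<ge> 1 \<and> z n = w} = Suc ` {i. z (Suc i) = w}"
      by (auto simp: image_iff) (metis Suc_le_D)
    hence "card {n. n \<ge> 1 \<and> z n = w} = card {i. z (Suc i) = w}"
      by (simp add: card_image)
    ultimately show "int (card {i. z (Suc i) = w}) = zorder f w"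
      using assms(4) unfolding zeros_by_modulus_def by metis
  next
    show "mono (\<lambda>i. norm (z (Suc i)))"
      using assms(4) unfolding zeros_by_modulus_def
      by (auto intro!: monoI dest: mono_onD)
  qed (use assms in \<open>auto simp: zeros_by_modulus_def transcendental_entire_def\<close>)
  define \<Lambda> where "\<Lambda> = (\<lambda>n. ln (ln (norm (z n))))"
  have "filterlim (\<lambda>r::real. ln (ln r)) at_top at_top" by real_asymp
  hence "filterlim (\<lambda>n. \<Lambda> (Suc n)) at_top sequentially"
    unfolding \<Lambda>_def using norm_at_top by (rule filterlim_compose)
  hence \<Lambda>_pos: "\<forall>\<^sub>F n in sequentially. \<Lambda> n > 0"
    unfolding filterlim_sequentially_Suc by (simp add: filterlim_at_top_dense)
  \<comment> \<open>Eventual positivity removes the norm, and the shift drops the arbitrary value at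
    index 0.\<close>
  have summable_\<Lambda>: "summable (\<lambda>n. norm (\<Lambda> n) powr (-s)) \<longleftrightarrow> summable (\<lambda>n. \<Lambda> (Suc n) powr (-s))" for s
  proof -
    have "summable (\<lambda>n. norm (\<Lambda> n) powr (-s)) \<longleftrightarrow> summable (\<lambda>n. \<Lambda> n powr (-s))"
      by (rule summable_cong) (use \<Lambda>_pos in \<open>auto elim: eventually_mono\<close>)
    thus ?thesis
      using summable_Suc_iff[of "\<lambda>n. \<Lambda> n powr (-s)"] by simp
  qed
  have "double_log_order f = convergence_exponent \<Lambda>"
  proof (subst convergence_exponent_eq)
    show "\<forall>\<^sub>F n in sequentially. norm (\<Lambda> n) > 0"
      using \<Lambda>_pos by (auto elim: eventually_mono)
    show "double_log_order f = (INF s\<in>{s. s > 0 \<and> summable (\<lambda>n. norm (\<Lambda> n) powr (-s))}. ereal s)"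
      unfolding double_log_order_def summable_\<Lambda> unfolding \<Lambda>_def
      by (intro antisym INF_ereal_le_INF_ereal)
         (auto intro: double_log_growth_of_summable[OF assms(2)] summable_of_double_log_growth)
  qed
  thus ?thesis using has_prod[OF assms(2)] unfolding \<Lambda>_def by blast
qed

end
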